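(* Consider the problem $\min_x f(x,\xi)$ subject to $h(x,\xi)=0$, $g(x,\xi)\le0$ with $\xi=\tilde\xi(t)$, where $\tilde\xi:\mathbb R_{\ge0}\to\mathbb R^r$. Assume that this problem admits a unique (global) optimizer $\tilde x^\star(t)$ for every $t\in\mathbb R_{\ge0}$ and that the solution map $\tilde x^\star:\mathbb R_{\ge0}\to\mathbb R^n$ is $\ell$-Lipschitz. Furthermore, let $x:\mathbb R_{\ge0}\to\mathbb R^n$ be absolutely continuous and assume that $$\langle\dot x(t),\,x(t)-\tilde x^\star(t)\rangle\le-a\,\|x(t)-\tilde x^\star(t)\|^2$$ holds for almost every $t\in\mathbb R_{\ge0}$, where $a\in\mathbb R_{>0}$. Then $$\limsup_{t\to\infty}\|x(t)-\tilde x^\star(t)\|\le\frac{\ell}{a}.$$ Moreover, if $\|x(0)-\tilde x^\star(0)\|\le\frac{\ell}{a}$, then $\|x(t)-\tilde x^\star(t)\|\le\frac{\ell}{a}$ holds for all $t\ge0$.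
   Context: Here $f:\mathbb R^n\times\Xi\to\mathbb R$, $h:\mathbb R^n\times\Xi\to\mathbb R^p$, $g:\mathbb R^n\times\Xi\to\mathbb R^m$ are twice continuously differentiable, $\Xi\subset\mathbb R^r$ contains the values of $\tilde\xi$, and $x\in\mathbb R^n$ is the decision variable. $\langle\cdot,\cdot\rangle$ and $\|\cdot\|$ are the Euclidean inner product and norm. Absolute continuity on $\mathbb R_{\ge0}$ is understood on every compact subinterval. *)

theory Defs
  imports "HOL-Analysis.Analysis"
begin

definition C2_on_open ::
    "('a::real_normed_vector \<Rightarrow> 'b::real_normed_vector) \<Rightarrow> 'a set \<Rightarrow> bool" where
  "C2_on_open F U \<longleftrightarrow> open U \<and>
     (\<exists>(D :: 'a \<Rightarrow> 'a \<Rightarrow>\<^sub>L 'b) (D2 :: 'a \<Rightarrow> 'a \<Rightarrow>\<^sub>L ('a \<Rightarrow>\<^sub>L 'b)).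
        (\<forall>z\<in>U. (F has_derivative blinfun_apply (D z)) (at z)) \<and>
        (\<forall>z\<in>U. (D has_derivative blinfun_apply (D2 z)) (at z)) \<and>
        continuous_on U D2)"

text \<open>On a set that need not be open, being twice continuously differentiable means
  having an extension of that kind to an open neighbourhood. For open \<open>S\<close> this coincides with
  \<^const>\<open>C2_on_open\<close>.\<close>

definition C2_on ::
    "('a::real_normed_vector \<Rightarrow> 'b::real_normed_vector) \<Rightarrow> 'a set \<Rightarrow> bool" where
  "C2_on f S \<longleftrightarrow> (\<exists>U F. S \<subseteq> U \<and> C2_on_open F U \<and> (\<forall>z\<in>S. F z = f z))"

text \<open>A pair \<open>(s, t)\<close> in \<open>I\<close> stands for the interval from \<open>s\<close> to \<open>t\<close>; only the open
  intervals have to be disjoint, so neighbours may share an endpoint.\<close>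

definition abs_continuous_on_interval ::
    "(real \<Rightarrow> 'a::real_normed_vector) \<Rightarrow> real \<Rightarrow> real \<Rightarrow> bool" where
  "abs_continuous_on_interval x b c \<longleftrightarrow>
     (\<forall>\<epsilon>>0. \<exists>\<delta>>0. \<forall>I :: (real \<times> real) set.
        finite I \<and>
        (\<forall>(s, t)\<in>I. b \<le> s \<and> s \<le> t \<and> t \<le> c) \<and>
        disjoint_family_on (\<lambda>(s, t). {s<..<t}) I \<and>
        (\<Sum>(s, t)\<in>I. t - s) < \<delta>
        \<longrightarrow> (\<Sum>(s, t)\<in>I. norm (x t - x s)) < \<epsilon>)"

definition abs_continuous_nonneg :: "(real \<Rightarrow> 'a::real_normed_vector) \<Rightarrow> bool" where
  "abs_continuous_nonneg x \<longleftrightarrow>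
     (\<forall>b c. 0 \<le> b \<and> b \<le> c \<longrightarrow> abs_continuous_on_interval x b c)"

text \<open>The order on \<^typ>\<open>real ^ 'm\<close> is the componentwise one.\<close>

definition feasible_set ::
    "((real ^ 'n) \<times> (real ^ 'r) \<Rightarrow> real ^ 'p) \<Rightarrow>
     ((real ^ 'n) \<times> (real ^ 'r) \<Rightarrow> real ^ 'm) \<Rightarrow> real ^ 'r \<Rightarrow> (real ^ 'n) set" where
  "feasible_set h g \<xi> = {z. h (z, \<xi>) = 0 \<and> g (z, \<xi>) \<le> 0}"

definition global_optimizer ::
    "((real ^ 'n) \<times> (real ^ 'r) \<Rightarrow> real) \<Rightarrow>
     ((real ^ 'n) \<times> (real ^ 'r) \<Rightarrow> real ^ 'p) \<Rightarrow>
     ((real ^ 'n) \<times> (real ^ 'r) \<Rightarrow> real ^ 'm) \<Rightarrow> real ^ 'r \<Rightarrow> real ^ 'n \<Rightarrow> bool" where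
  "global_optimizer f h g \<xi> = is_arg_min (\<lambda>z. f (z, \<xi>)) (\<lambda>z. z \<in> feasible_set h g \<xi>)"

end

theory Submission
  imports Defs
begin

text \<open>
  The claim concerns the scalar function \<open>u t = norm (x t - xstar t)\<close>. Formally
  \<open>u' \<le> l - a * u\<close> wherever \<open>u > 0\<close>: the flow of \<open>x\<close> decreases the distance to the momentary
  optimizer at rate \<open>a * u\<close>, while the optimizer moves at speed at most \<open>l\<close>. Above the level
  \<open>l / a\<close> the right-hand side is negative, so \<open>u\<close> cannot climb across any level \<open>r \<ge> l / a\<close>;
  and above a level \<open>r > l / a\<close> it decreases at least at the rate \<open>a * r - l > 0\<close>, so, being
  nonnegative, it must reach a value at most \<open>r\<close> in finite time, and then never exceeds \<open>r\<close> again.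

  Since \<open>xstar\<close>, and with it \<open>u\<close>, may fail to be differentiable at a given time, the inequality for
  \<open>u'\<close> is read as a bound on secants. If \<open>x\<close> is
  differentiable at \<open>t\<close> and \<open>u t > 0\<close>, then near \<open>t\<close> the function \<open>u\<close> differs from the differentiable
  function \<open>s \<mapsto> norm (x s - xstar t)\<close> by at most \<open>l * \<bar>s - t\<bar>\<close>, which bounds the slopes of all
  secants of \<open>u\<close> over short intervals around \<open>t\<close> (\<open>straddling_slope_dist_lipschitz\<close>). For an
  absolutely continuous function such a bound at almost every point integrates to a bound on the
  increment (\<open>abs_continuous_slope_bound\<close>): a fine tagged division splits the increment into
  intervals tagged by good points, where the slope bound applies, and intervals tagged in the null
  set, whose total length is so small that absolute continuity makes their contribution negligible.
\<close>

section \<open>Monotonicity from almost everywhere slope bounds\<close>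

text \<open>An upper derivative bound in its two-sided form, for secants over intervals containing \<open>t\<close>.
  This is the form that a tag in a tagged division asks for, since a tag need not be an
  endpoint of its interval.\<close>

definition straddling_slope_le :: "(real \<Rightarrow> real) \<Rightarrow> real set \<Rightarrow> real \<Rightarrow> real \<Rightarrow> bool" where
  "straddling_slope_le \<phi> S D t \<longleftrightarrow>
     (\<forall>\<epsilon>>0. \<exists>d>0. \<forall>s s'. s \<in> S \<inter> ball t d \<and> s' \<in> S \<inter> ball t d \<and> s \<le> t \<and> t \<le> s' \<longrightarrow>
        \<phi> s' - \<phi> s \<le> (D + \<epsilon>) * (s' - s))"

lemma straddling_slope_le_mono:
  assumes "straddling_slope_le \<phi> S D t" "S' \<subseteq> S" "D \<le> D'"
  shows "straddling_slope_le \<phi> S' D' t"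
  unfolding straddling_slope_le_def
proof (intro allI impI)
  fix \<epsilon> :: real assume "\<epsilon> > 0"
  then obtain d where d: "d > 0"
    and *: "\<And>s s'. s \<in> S \<inter> ball t d \<and> s' \<in> S \<inter> ball t d \<and> s \<le> t \<and> t \<le> s' \<Longrightarrow>
        \<phi> s' - \<phi> s \<le> (D + \<epsilon>) * (s' - s)"
    using assms(1) unfolding straddling_slope_le_def by blast
  show "\<exists>d>0. \<forall>s s'. s \<in> S' \<inter> ball t d \<and> s' \<in> S' \<inter> ball t d \<and> s \<le> t \<and> t \<le> s' \<longrightarrow>
        \<phi> s' - \<phi> s \<le> (D' + \<epsilon>) * (s' - s)"
  proof (intro exI conjI allI impI)
    show "d > 0" by fact
    fix s s' assume A: "s \<in> S' \<inter> ball t d \<and> s' \<in> S' \<inter> ball t d \<and> s \<le> t \<and> t \<le> s'"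
    then have "\<phi> s' - \<phi> s \<le> (D + \<epsilon>) * (s' - s)"
      using *[of s s'] assms(2) by blast
    also have "\<dots> \<le> (D' + \<epsilon>) * (s' - s)"
      using A assms(3) by (intro mult_right_mono) auto
    finally show "\<phi> s' - \<phi> s \<le> (D' + \<epsilon>) * (s' - s)" .
  qed
qed

text \<open>The first-order error terms to the left and to the right of \<open>t\<close> add up to at most
  \<open>\<epsilon> * (s' - s)\<close> because \<open>t\<close> lies between \<open>s\<close> and \<open>s'\<close>.\<close>

lemma has_real_derivative_imp_straddling_slope_le:
  assumes "(\<phi> has_real_derivative D) (at t)"
  shows "straddling_slope_le \<phi> S D t"
  unfolding straddling_slope_le_def
proof (intro allI impI)
  fix \<epsilon> :: real assume "\<epsilon> > 0"
  then obtain d where d: "d > 0"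
    and *: "\<And>y. \<bar>y - t\<bar> < d \<Longrightarrow> \<bar>\<phi> y - \<phi> t - D * (y - t)\<bar> \<le> \<epsilon> * \<bar>y - t\<bar>"
    using assms unfolding has_field_derivative_def has_derivative_at_alt real_norm_def by blast
  show "\<exists>d>0. \<forall>s s'. s \<in> S \<inter> ball t d \<and> s' \<in> S \<inter> ball t d \<and> s \<le> t \<and> t \<le> s' \<longrightarrow>
        \<phi> s' - \<phi> s \<le> (D + \<epsilon>) * (s' - s)"
  proof (intro exI conjI allI impI)
    show "d > 0" by fact
    fix s s' assume "s \<in> S \<inter> ball t d \<and> s' \<in> S \<inter> ball t d \<and> s \<le> t \<and> t \<le> s'"
    then show "\<phi> s' - \<phi> s \<le> (D + \<epsilon>) * (s' - s)"
      using *[of s] *[of s'] by (auto simp: dist_real_def algebra_simps abs_le_iff)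
  qed
qed

lemma sum_lengths_le_measure:
  fixes I :: "(real \<times> real) set"
  assumes "finite I" "disjoint_family_on (\<lambda>(s, t). {s<..<t}) I"
    and le: "\<And>s t. (s, t) \<in> I \<Longrightarrow> s \<le> t"
    and sub: "\<And>s t. (s, t) \<in> I \<Longrightarrow> {s<..<t} \<subseteq> U"
    and U: "U \<in> lmeasurable"
  shows "(\<Sum>(s, t)\<in>I. t - s) \<le> measure lebesgue U"
proof -
  have "(\<Sum>(s, t)\<in>I. t - s) = (\<Sum>i\<in>I. measure lebesgue (case i of (s, t) \<Rightarrow> {s<..<t}))"
    using le by (intro sum.cong) (auto simp: measure_completion)
  also have "\<dots> = measure lebesgue (\<Union>i\<in>I. case i of (s, t) \<Rightarrow> {s<..<t})"
    using assms le by (intro measure_finite_Union[symmetric]) (auto simp: emeasure_completion)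
  also have "\<dots> \<le> measure lebesgue U"
    using sub \<open>finite I\<close> by (intro measure_mono_fmeasurable U sets.finite_UN) auto
  finally show ?thesis .
qed

text \<open>Absolute continuity is phrased with sets of endpoint pairs, tagged divisions with tagged
  sets. Passing from one to the other may identify elements only when they are degenerate
  intervals, since interiors are disjoint; hence the condition \<open>F t t = 0\<close> for transferring sums.\<close>

lemma tagged_partial_division_endpoints:
  assumes p: "p tagged_partial_division_of {b..c::real}"
  defines "I \<equiv> (\<lambda>(t, K). (Inf K, Sup K)) ` p"
  shows "finite I"
    and "\<And>t K. (t, K) \<in> p \<Longrightarrow> K = {Inf K..Sup K} \<and> b \<le> Inf K \<and> Inf K \<le> t \<and> t \<le> Sup K \<and> Sup K \<le> c"
    and "disjoint_family_on (\<lambda>(s, t). {s<..<t}) I"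
    and "\<And>F :: real \<Rightarrow> real \<Rightarrow> real. (\<And>t. F t t = 0) \<Longrightarrow>
           (\<Sum>(t, K)\<in>p. F (Inf K) (Sup K)) = (\<Sum>(s, t)\<in>I. F s t)"
proof -
  show fin: "finite I"
    using p unfolding I_def tagged_partial_division_of_def by blast
  show K: "K = {Inf K..Sup K} \<and> b \<le> Inf K \<and> Inf K \<le> t \<and> t \<le> Sup K \<and> Sup K \<le> c" if tK: "(t, K) \<in> p" for t K
  proof -
    obtain u v where "K = {u..v}" "t \<in> K" "K \<subseteq> {b..c}"
      using tagged_partial_division_ofD(2,3,4)[OF p tK] unfolding cbox_interval by blast
    then show ?thesis by auto
  qed
  have disj: "{Inf K<..<Sup K} \<inter> {Inf L<..<Sup L} = {}"
    if "(t, K) \<in> p" "(t', L) \<in> p" "(t, K) \<noteq> (t', L)" for t t' K L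
  proof -
    have "interior K \<inter> interior L = {}"
      using p that unfolding tagged_partial_division_of_def by blast
    moreover have "interior K = {Inf K<..<Sup K}" "interior L = {Inf L<..<Sup L}"
      using arg_cong[OF K[OF that(1), THEN conjunct1], of interior]
        arg_cong[OF K[OF that(2), THEN conjunct1], of interior] by simp_all
    ultimately show ?thesis by simp
  qed
  show "disjoint_family_on (\<lambda>(s, t). {s<..<t}) I"
    unfolding disjoint_family_on_def
  proof (intro ballI impI)
    fix i j assume "i \<in> I" "j \<in> I" "i \<noteq> j"
    then obtain t K t' L where "(t, K) \<in> p" "(t', L) \<in> p" "(t, K) \<noteq> (t', L)"
      "i = (Inf K, Sup K)" "j = (Inf L, Sup L)"
      unfolding I_def by force
    then show "(case i of (s, t) \<Rightarrow> {s<..<t}) \<inter> (case j of (s, t) \<Rightarrow> {s<..<t}) = {}"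
      using disj by simp
  qed
  fix F :: "real \<Rightarrow> real \<Rightarrow> real" assume F: "\<And>t. F t t = 0"
  have "finite p" using p unfolding tagged_partial_division_of_def by blast
  have "(\<Sum>(s, t)\<in>I. F s t) = sum ((\<lambda>(s, t). F s t) \<circ> (\<lambda>(t, K). (Inf K, Sup K))) p"
    unfolding I_def
  proof (rule sum.reindex_nontrivial[OF \<open>finite p\<close>])
    fix i j assume ij: "i \<in> p" "j \<in> p" "i \<noteq> j"
      "(case i of (t, K) \<Rightarrow> (Inf K, Sup K)) = (case j of (t, K) \<Rightarrow> (Inf K, Sup K))"
    obtain t K t' L where tK: "i = (t, K)" "j = (t', L)" by fastforce
    with ij have "{Inf K<..<Sup K} = {}" using disj[of t K t' L] by auto
    moreover have "Inf K \<le> Sup K" using K[of t K] ij tK by auto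
    ultimately have "Inf K = Sup K" by auto
    then show "(case (case i of (t, K) \<Rightarrow> (Inf K, Sup K)) of (s, t) \<Rightarrow> F s t) = 0"
      using F tK by simp
  qed
  then show "(\<Sum>(t, K)\<in>p. F (Inf K) (Sup K)) = (\<Sum>(s, t)\<in>I. F s t)"
    by (simp add: case_prod_unfold comp_def)
qed

lemma null_set_outer_open:
  fixes N :: "real set"
  assumes "N \<in> null_sets lebesgue" "\<delta> > 0"
  obtains U where "open U" "N \<subseteq> U" "U \<in> lmeasurable" "measure lebesgue U < \<delta>"
proof -
  obtain U where U: "open U" "N \<subseteq> U" "U - N \<in> lmeasurable" "emeasure lebesgue (U - N) < ennreal \<delta>"
    using sets_lebesgue_outer_open[of N \<delta>] assms by blast
  have "U \<in> sets lebesgue" using U(1) by auto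
  then have eq: "emeasure lebesgue U = emeasure lebesgue (U - N)"
    using assms(1) by (simp add: emeasure_Diff_null_set)
  have "U \<in> lmeasurable"
    using \<open>U \<in> sets lebesgue\<close> U(3) eq by (auto simp: fmeasurable_def)
  moreover have "measure lebesgue U < \<delta>"
    using U(4) unfolding eq[symmetric] emeasure_eq_measure2[OF \<open>U \<in> lmeasurable\<close>]
    by (simp add: ennreal_less_iff)
  ultimately show thesis using that U by blast
qed

text \<open>The inequality half of the fundamental theorem of calculus.
  The gauge is \<open>U\<close>, a small open neighbourhood of the null set \<open>N\<close>, at the points of \<open>N\<close>, and a ball
  that realizes the slope bound \<open>D + \<epsilon>\<close> at the other points. The intervals tagged in \<open>N\<close> lie in
  \<open>U\<close>, so their total length is small, and absolute continuity controls the increment over them.\<close>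

lemma abs_continuous_slope_bound:
  fixes \<phi> :: "real \<Rightarrow> real"
  assumes ac: "abs_continuous_on_interval \<phi> b c" and "b \<le> c"
    and N: "N \<in> null_sets lebesgue"
    and slope: "\<And>t. t \<in> {b..c} - N \<Longrightarrow> straddling_slope_le \<phi> {b..c} D t"
  shows "\<phi> c - \<phi> b \<le> D * (c - b)"
proof (rule field_le_epsilon)
  fix e :: real assume "e > 0"
  \<comment> \<open>The three terms of the denominator pay for the slope slack over the whole interval, the
    increments over the intervals tagged in \<open>N\<close>, and the term \<open>D * length\<close> of these intervals, which
    the slope bound counts although \<open>D\<close> may be negative.\<close>
  define \<epsilon> where "\<epsilon> = e / (c - b + 1 + \<bar>D\<bar>)"
  have \<epsilon>: "\<epsilon> > 0" using \<open>e > 0\<close> \<open>b \<le> c\<close> unfolding \<epsilon>_def by (intro divide_pos_pos) auto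
  have e_eq: "e = \<epsilon> * (c - b + 1 + \<bar>D\<bar>)" using \<open>b \<le> c\<close> by (simp add: \<epsilon>_def)
  obtain \<delta> where "\<delta> > 0" and \<delta>: "\<And>I :: (real \<times> real) set. finite I \<and>
        (\<forall>(s, t)\<in>I. b \<le> s \<and> s \<le> t \<and> t \<le> c) \<and>
        disjoint_family_on (\<lambda>(s, t). {s<..<t}) I \<and>
        (\<Sum>(s, t)\<in>I. t - s) < \<delta> \<Longrightarrow> (\<Sum>(s, t)\<in>I. norm (\<phi> t - \<phi> s)) < \<epsilon>"
    using ac \<epsilon> unfolding abs_continuous_on_interval_def by meson
  obtain U where U: "open U" "N \<subseteq> U" "U \<in> lmeasurable" "measure lebesgue U < min \<delta> \<epsilon>"
    using null_set_outer_open[OF N, of "min \<delta> \<epsilon>"] \<open>\<delta> > 0\<close> \<epsilon> by auto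
  have "\<forall>t\<in>{b..c} - N. \<exists>d>0. \<forall>s s'. s \<in> {b..c} \<inter> ball t d \<and> s' \<in> {b..c} \<inter> ball t d \<and>
      s \<le> t \<and> t \<le> s' \<longrightarrow> \<phi> s' - \<phi> s \<le> (D + \<epsilon>) * (s' - s)"
    using slope \<epsilon> unfolding straddling_slope_le_def by blast
  then obtain d where d: "\<And>t. t \<in> {b..c} - N \<Longrightarrow> d t > 0"
    "\<And>t s s'. t \<in> {b..c} - N \<Longrightarrow> s \<in> {b..c} \<inter> ball t (d t) \<and> s' \<in> {b..c} \<inter> ball t (d t) \<and>
      s \<le> t \<and> t \<le> s' \<Longrightarrow> \<phi> s' - \<phi> s \<le> (D + \<epsilon>) * (s' - s)"
    by metis
  define \<gamma> where "\<gamma> t = (if t \<in> N then U else if t \<in> {b..c} then ball t (d t) else UNIV)" for t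
  have "gauge \<gamma>"
    using U d(1) unfolding gauge_def \<gamma>_def by auto
  then obtain p where p: "p tagged_division_of {b..c}" "\<gamma> fine p"
    using fine_division_exists_real by blast
  have "finite p" and pp: "p tagged_partial_division_of {b..c}"
    using p unfolding tagged_division_of_def tagged_partial_division_of_def by blast+
  define q where "q = {(t, K) \<in> p. t \<in> N}"
  define I where "I = (\<lambda>(t, K). (Inf K, Sup K)) ` q"
  have qp: "q \<subseteq> p" unfolding q_def by auto
  then have q: "q tagged_partial_division_of {b..c}"
    using pp tagged_partial_division_subset by blast
  note P = tagged_partial_division_endpoints[OF pp]
  note Q = tagged_partial_division_endpoints[OF q, folded I_def]
  have I_len: "(\<Sum>(s, t)\<in>I. t - s) \<le> measure lebesgue U"
  proof (rule sum_lengths_le_measure[OF Q(1) Q(3) _ _ U(3)])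
    fix s t assume "(s, t) \<in> I"
    then obtain \<tau> K where K: "(\<tau>, K) \<in> q" "s = Inf K" "t = Sup K"
      unfolding I_def by auto
    then show "s \<le> t" using Q(2)[OF K(1)] by linarith
    have "(\<tau>, K) \<in> p" "\<tau> \<in> N" using K(1) unfolding q_def by auto
    then have "K \<subseteq> U" using fineD[OF p(2)] unfolding \<gamma>_def by fastforce
    moreover have "{s<..<t} \<subseteq> {Inf K..Sup K}" using K by auto
    ultimately show "{s<..<t} \<subseteq> U" using Q(2)[OF K(1)] by blast
  qed
  have I_sub: "\<forall>(s, t)\<in>I. b \<le> s \<and> s \<le> t \<and> t \<le> c"
  proof clarify
    fix s t assume "(s, t) \<in> I"
    then obtain \<tau> K where K: "(\<tau>, K) \<in> q" "s = Inf K" "t = Sup K"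
      unfolding I_def by auto
    then show "b \<le> s \<and> s \<le> t \<and> t \<le> c" using Q(2)[OF K(1)] by linarith
  qed
  have "(\<Sum>(s, t)\<in>I. norm (\<phi> t - \<phi> s)) < \<epsilon>"
    using U(4) I_len I_sub Q(1,3) by (intro \<delta>) auto
  then have bad: "(\<Sum>(t, K)\<in>q. norm (\<phi> (Sup K) - \<phi> (Inf K))) < \<epsilon>"
    using Q(4)[of "\<lambda>s t. norm (\<phi> t - \<phi> s)"] by simp
  have bad_len: "(\<Sum>(t, K)\<in>q. Sup K - Inf K) < \<epsilon>"
    using Q(4)[of "\<lambda>s t. t - s"] I_len U(4) by simp
  have len: "(\<Sum>(t, K)\<in>p. Sup K - Inf K) = c - b"
    using additive_tagged_division_1[OF \<open>b \<le> c\<close> p(1), of "\<lambda>t. t"] by simp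
  define err where "err = (\<lambda>(t :: real, K). norm (\<phi> (Sup K) - \<phi> (Inf K)) + \<bar>D\<bar> * (Sup K - Inf K))"
  have step: "(case i of (t, K) \<Rightarrow> \<phi> (Sup K) - \<phi> (Inf K))
      \<le> (case i of (t, K) \<Rightarrow> (D + \<epsilon>) * (Sup K - Inf K)) + (if i \<in> q then err i else 0)"
    if "i \<in> p" for i
  proof -
    obtain t K where i: "i = (t, K)" by fastforce
    have tK: "K = {Inf K..Sup K}" "b \<le> Inf K" "Inf K \<le> t" "t \<le> Sup K" "Sup K \<le> c"
      using P(2) that i by blast+
    show ?thesis
    proof (cases "t \<in> N")
      case True
      then have "i \<in> q" using that i unfolding q_def by simp
      moreover have "\<phi> (Sup K) - \<phi> (Inf K) \<le> norm (\<phi> (Sup K) - \<phi> (Inf K))" by simp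
      moreover have "0 \<le> (D + \<bar>D\<bar> + \<epsilon>) * (Sup K - Inf K)"
        using \<epsilon> tK by (intro mult_nonneg_nonneg) auto
      ultimately show ?thesis unfolding i err_def by (simp add: algebra_simps)
    next
      case False
      then have t: "t \<in> {b..c} - N" using tK by auto
      have "K \<subseteq> ball t (d t)"
        using fineD[OF p(2), of t K] that i t unfolding \<gamma>_def by simp
      moreover have "Inf K \<in> K" "Sup K \<in> K" using tK
        by (metis atLeastAtMost_iff order.trans order_refl)+
      ultimately have "\<phi> (Sup K) - \<phi> (Inf K) \<le> (D + \<epsilon>) * (Sup K - Inf K)"
        using tK by (intro d(2)[OF t]) auto
      moreover have "i \<notin> q" using False i unfolding q_def by simp
      ultimately show ?thesis unfolding i by simp
    qed
  qed
  have "\<phi> c - \<phi> b = (\<Sum>(t, K)\<in>p. \<phi> (Sup K) - \<phi> (Inf K))"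
    using additive_tagged_division_1[OF \<open>b \<le> c\<close> p(1), of \<phi>] by simp
  also have "\<dots> \<le> (\<Sum>i\<in>p. (case i of (t, K) \<Rightarrow> (D + \<epsilon>) * (Sup K - Inf K)) + (if i \<in> q then err i else 0))"
    by (rule sum_mono) (rule step)
  also have "\<dots> = (D + \<epsilon>) * (\<Sum>(t, K)\<in>p. Sup K - Inf K) + sum err q"
    using sum.inter_restrict[OF \<open>finite p\<close>, of err q, symmetric] qp
    by (simp add: sum.distrib sum_distrib_left case_prod_unfold Int_absorb1)
  also have "sum err q = (\<Sum>(t, K)\<in>q. norm (\<phi> (Sup K) - \<phi> (Inf K))) + \<bar>D\<bar> * (\<Sum>(t, K)\<in>q. Sup K - Inf K)"
    by (simp add: err_def sum.distrib sum_distrib_left case_prod_unfold)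
  also have "(D + \<epsilon>) * (\<Sum>(t, K)\<in>p. Sup K - Inf K) + \<dots> \<le> (D + \<epsilon>) * (c - b) + (\<epsilon> + \<bar>D\<bar> * \<epsilon>)"
    unfolding len using bad bad_len by (intro add_left_mono add_mono mult_left_mono) auto
  also have "\<dots> = D * (c - b) + e"
    unfolding e_eq by (simp add: algebra_simps)
  finally show "\<phi> c - \<phi> b \<le> D * (c - b) + e" .
qed

lemma abs_continuous_on_interval_imp_continuous_on:
  assumes "abs_continuous_on_interval \<phi> b c"
  shows "continuous_on {b..c} \<phi>"
  unfolding continuous_on_iff
proof (intro ballI allI impI)
  fix t \<epsilon> :: real assume t: "t \<in> {b..c}" and "\<epsilon> > 0"
  obtain \<delta> where "\<delta> > 0" and \<delta>: "\<And>I :: (real \<times> real) set. finite I \<and>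
        (\<forall>(s, t)\<in>I. b \<le> s \<and> s \<le> t \<and> t \<le> c) \<and>
        disjoint_family_on (\<lambda>(s, t). {s<..<t}) I \<and>
        (\<Sum>(s, t)\<in>I. t - s) < \<delta> \<Longrightarrow> (\<Sum>(s, t)\<in>I. norm (\<phi> t - \<phi> s)) < \<epsilon>"
    using assms \<open>\<epsilon> > 0\<close> unfolding abs_continuous_on_interval_def by meson
  have "dist (\<phi> s) (\<phi> t) < \<epsilon>" if "s \<in> {b..c}" "dist s t < \<delta>" for s
    using \<delta>[of "{(min s t, max s t)}"] t that
    by (cases "s \<le> t") (auto simp: disjoint_family_on_def dist_norm norm_minus_commute)
  with \<open>\<delta> > 0\<close> show "\<exists>d>0. \<forall>s\<in>{b..c}. dist s t < d \<longrightarrow> dist (\<phi> s) (\<phi> t) < \<epsilon>"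
    by blast
qed

lemma abs_continuous_on_interval_subset:
  assumes "abs_continuous_on_interval \<phi> b c" "b \<le> b'" "c' \<le> c"
  shows "abs_continuous_on_interval \<phi> b' c'"
  unfolding abs_continuous_on_interval_def
proof (intro allI impI)
  fix \<epsilon> :: real assume "\<epsilon> > 0"
  then obtain \<delta> where "\<delta> > 0" and \<delta>: "\<And>I :: (real \<times> real) set. finite I \<and>
        (\<forall>(s, t)\<in>I. b \<le> s \<and> s \<le> t \<and> t \<le> c) \<and>
        disjoint_family_on (\<lambda>(s, t). {s<..<t}) I \<and>
        (\<Sum>(s, t)\<in>I. t - s) < \<delta> \<Longrightarrow> (\<Sum>(s, t)\<in>I. norm (\<phi> t - \<phi> s)) < \<epsilon>"
    using assms(1) unfolding abs_continuous_on_interval_def by meson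
  show "\<exists>\<delta>>0. \<forall>I :: (real \<times> real) set. finite I \<and>
        (\<forall>(s, t)\<in>I. b' \<le> s \<and> s \<le> t \<and> t \<le> c') \<and>
        disjoint_family_on (\<lambda>(s, t). {s<..<t}) I \<and>
        (\<Sum>(s, t)\<in>I. t - s) < \<delta> \<longrightarrow> (\<Sum>(s, t)\<in>I. norm (\<phi> t - \<phi> s)) < \<epsilon>"
    using \<open>\<delta> > 0\<close> assms(2,3) by (intro exI[of _ \<delta>] conjI allI impI \<delta>) fastforce+
qed

text \<open>If \<open>\<phi>\<close> ended above \<open>r\<close>, there would be a last time \<open>m\<close> at which it is at most \<open>r\<close>. After \<open>m\<close>
  the slope bound is available almost everywhere, so \<open>\<phi> c \<le> \<phi> m \<le> r\<close>.\<close>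

lemma abs_continuous_stays_below:
  fixes \<phi> :: "real \<Rightarrow> real"
  assumes ac: "abs_continuous_on_interval \<phi> b c" and "b \<le> c"
    and N: "N \<in> null_sets lebesgue"
    and slope: "\<And>t. t \<in> {b..c} - N \<Longrightarrow> \<phi> t > r \<Longrightarrow> straddling_slope_le \<phi> {b..c} 0 t"
    and start: "\<phi> b \<le> r"
  shows "\<phi> c \<le> r"
proof -
  define A where "A = {t \<in> {b..c}. \<phi> t \<le> r}"
  have "closed A"
    unfolding A_def
    by (intro continuous_on_closed_Collect_le abs_continuous_on_interval_imp_continuous_on[OF ac]
        continuous_on_const closed_atLeastAtMost)
  moreover have "A = {b..c} \<inter> A" by (auto simp: A_def)
  ultimately have "compact A" using compact_Int_closed[OF compact_Icc] by metis
  moreover have "A \<noteq> {}" using start \<open>b \<le> c\<close> by (auto simp: A_def)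
  ultimately obtain m where m: "m \<in> A" "\<And>t. t \<in> A \<Longrightarrow> t \<le> m"
    using compact_attains_sup by metis
  have mbc: "b \<le> m" "m \<le> c" "\<phi> m \<le> r" using m(1) by (auto simp: A_def)
  have "\<phi> c - \<phi> m \<le> 0 * (c - m)"
  proof (rule abs_continuous_slope_bound)
    show "abs_continuous_on_interval \<phi> m c"
      using ac mbc(1) by (rule abs_continuous_on_interval_subset) simp
    show "m \<le> c" by fact
    \<comment> \<open>The time \<open>m\<close> itself is not above the level, so it joins the exceptional set.\<close>
    show "insert m N \<in> null_sets lebesgue"
      using N by (simp flip: negligible_iff_null_sets)
    fix t assume t: "t \<in> {m..c} - insert m N"
    then have "\<phi> t > r" using m(2)[of t] mbc by (force simp: A_def)
    then have "straddling_slope_le \<phi> {b..c} 0 t" using slope t mbc by auto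
    then show "straddling_slope_le \<phi> {m..c} 0 t"
      by (rule straddling_slope_le_mono) (use mbc in auto)
  qed
  then show ?thesis using mbc by simp
qed

section \<open>Distance to a Lipschitz curve\<close>

lemma abs_continuous_dist_lipschitz:
  fixes x y :: "real \<Rightarrow> 'a :: real_normed_vector"
  assumes ac: "abs_continuous_on_interval x b c" and y: "l-lipschitz_on {b..c} y"
  shows "abs_continuous_on_interval (\<lambda>t. norm (x t - y t)) b c"
  unfolding abs_continuous_on_interval_def
proof (intro allI impI)
  fix \<epsilon> :: real assume "\<epsilon> > 0"
  then have "\<epsilon> / 2 > 0" by simp
  then obtain \<delta> where "\<delta> > 0" and \<delta>: "\<And>I :: (real \<times> real) set. finite I \<and>
        (\<forall>(s, t)\<in>I. b \<le> s \<and> s \<le> t \<and> t \<le> c) \<and>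
        disjoint_family_on (\<lambda>(s, t). {s<..<t}) I \<and>
        (\<Sum>(s, t)\<in>I. t - s) < \<delta> \<Longrightarrow> (\<Sum>(s, t)\<in>I. norm (x t - x s)) < \<epsilon> / 2"
    using ac unfolding abs_continuous_on_interval_def by meson
  have "l \<ge> 0" using y by (rule lipschitz_on_nonneg)
  define \<delta>' where "\<delta>' = min \<delta> (\<epsilon> / (2 * (l + 1)))"
  have \<delta>': "\<delta>' > 0" "\<delta>' \<le> \<delta>" "\<delta>' \<le> \<epsilon> / (2 * (l + 1))"
    using \<open>\<delta> > 0\<close> \<open>\<epsilon> > 0\<close> \<open>l \<ge> 0\<close> by (auto simp: \<delta>'_def)
  have small: "l * \<delta>' \<le> \<epsilon> / 2"
  proof -
    have "l * \<delta>' \<le> (l + 1) * (\<epsilon> / (2 * (l + 1)))"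
      using \<delta>' \<open>l \<ge> 0\<close> by (intro mult_mono) auto
    also have "\<dots> = \<epsilon> / 2" using \<open>l \<ge> 0\<close> by (simp add: field_simps)
    finally show ?thesis .
  qed
  show "\<exists>\<delta>>0. \<forall>I :: (real \<times> real) set. finite I \<and>
        (\<forall>(s, t)\<in>I. b \<le> s \<and> s \<le> t \<and> t \<le> c) \<and>
        disjoint_family_on (\<lambda>(s, t). {s<..<t}) I \<and>
        (\<Sum>(s, t)\<in>I. t - s) < \<delta> \<longrightarrow>
        (\<Sum>(s, t)\<in>I. norm (norm (x t - y t) - norm (x s - y s))) < \<epsilon>"
  proof (intro exI conjI allI impI)
    show "\<delta>' > 0" by fact
    fix I :: "(real \<times> real) set"
    assume I: "finite I \<and> (\<forall>(s, t)\<in>I. b \<le> s \<and> s \<le> t \<and> t \<le> c) \<and>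
        disjoint_family_on (\<lambda>(s, t). {s<..<t}) I \<and> (\<Sum>(s, t)\<in>I. t - s) < \<delta>'"
    have "(\<Sum>(s, t)\<in>I. norm (norm (x t - y t) - norm (x s - y s)))
        \<le> (\<Sum>(s, t)\<in>I. norm (x t - x s) + l * (t - s))"
    proof (rule sum_mono, clarify)
      fix s t assume "(s, t) \<in> I"
      then have st: "b \<le> s" "s \<le> t" "t \<le> c" using I by auto
      have "norm (norm (x t - y t) - norm (x s - y s)) \<le> norm ((x t - y t) - (x s - y s))"
        using norm_triangle_ineq3 by simp
      also have "\<dots> = norm ((x t - x s) - (y t - y s))" by (simp add: algebra_simps)
      also have "\<dots> \<le> norm (x t - x s) + norm (y t - y s)" by (rule norm_triangle_ineq4)
      also have "norm (y t - y s) \<le> l * (t - s)"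
        using lipschitz_on_normD[OF y, of t s] st by simp
      finally show "norm (norm (x t - y t) - norm (x s - y s)) \<le> norm (x t - x s) + l * (t - s)"
        by simp
    qed
    also have "\<dots> = (\<Sum>(s, t)\<in>I. norm (x t - x s)) + l * (\<Sum>(s, t)\<in>I. t - s)"
      by (simp add: case_prod_unfold sum.distrib sum_distrib_left)
    also have "\<dots> < \<epsilon> / 2 + l * \<delta>'"
      using I \<delta>'(2) \<open>l \<ge> 0\<close> by (intro add_less_le_mono \<delta> mult_left_mono) auto
    also have "\<dots> \<le> \<epsilon>" using small by simp
    finally show "(\<Sum>(s, t)\<in>I. norm (norm (x t - y t) - norm (x s - y s))) < \<epsilon>" .
  qed
qed

text \<open>Freezing \<open>y\<close> at time \<open>t\<close> leaves a function differentiable at \<open>t\<close>, whose derivative the hypothesis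
  on \<open>v\<close> bounds by \<open>- a * norm (x t - y t)\<close>; the motion of \<open>y\<close> adds at most \<open>l\<close> to the slope. Freezing
  at \<open>t\<close> works on both sides because moving from \<open>s\<close> to \<open>t\<close> and from \<open>t\<close> to \<open>s'\<close> costs
  \<open>l * (t - s) + l * (s' - t)\<close> in total. The norm is differentiable only away from \<open>0\<close>, hence
  \<open>x t \<noteq> y t\<close>.\<close>

lemma straddling_slope_dist_lipschitz:
  fixes x y :: "real \<Rightarrow> 'a :: real_inner"
  assumes x': "(x has_vector_derivative v) (at t)" and y: "l-lipschitz_on S y"
    and "t \<in> S" and ne: "x t \<noteq> y t"
    and v: "v \<bullet> (x t - y t) \<le> - a * (norm (x t - y t))\<^sup>2"
  shows "straddling_slope_le (\<lambda>s. norm (x s - y s)) S (l - a * norm (x t - y t)) t"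
proof -
  define e where "e = x t - y t"
  have "e \<noteq> 0" using ne by (simp add: e_def)
  define w where "w = (\<lambda>s. norm (x s - y t))"
  have "((\<lambda>s. x s - y t) has_derivative (\<lambda>h. h *\<^sub>R v)) (at t)"
    using x' unfolding has_vector_derivative_def by (auto intro!: derivative_eq_intros)
  from has_derivative_compose[OF this has_derivative_norm[of "x t - y t"]]
  have "(w has_real_derivative (v \<bullet> sgn e)) (at t)"
    using ne unfolding has_field_derivative_def w_def e_def
    by (simp add: inner_commute mult_commute_abs mult.commute[of _ "sgn _ \<bullet> _"])
  moreover have "v \<bullet> sgn e \<le> - a * norm e"
    using v \<open>e \<noteq> 0\<close> unfolding e_def[symmetric] sgn_div_norm
    by (simp add: field_simps power2_eq_square)
  ultimately have w: "straddling_slope_le w S (- a * norm e) t"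
    using has_real_derivative_imp_straddling_slope_le straddling_slope_le_mono by blast
  have compare: "norm (x s' - y s') - norm (x s - y s) \<le> w s' - w s + l * (s' - s)"
    if "s \<in> S" "s' \<in> S" "s \<le> t" "t \<le> s'" for s s'
  proof -
    have "norm (x s' - y s') \<le> w s' + norm (y t - y s')"
      unfolding w_def using norm_triangle_ineq[of "x s' - y t" "y t - y s'"] by simp
    moreover have "w s \<le> norm (x s - y s) + norm (y s - y t)"
      unfolding w_def using norm_triangle_ineq[of "x s - y s" "y s - y t"] by simp
    moreover have "norm (y t - y s') \<le> l * (s' - t)" "norm (y s - y t) \<le> l * (t - s)"
      using lipschitz_on_normD[OF y, of t s'] lipschitz_on_normD[OF y, of s t] that \<open>t \<in> S\<close> by simp_all
    ultimately show ?thesis by (simp add: algebra_simps)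
  qed
  show ?thesis
    unfolding straddling_slope_le_def
  proof (intro allI impI)
    fix \<epsilon> :: real assume "\<epsilon> > 0"
    then obtain d where d: "d > 0"
      and *: "\<And>s s'. s \<in> S \<inter> ball t d \<and> s' \<in> S \<inter> ball t d \<and> s \<le> t \<and> t \<le> s' \<Longrightarrow>
          w s' - w s \<le> (- a * norm e + \<epsilon>) * (s' - s)"
      using w unfolding straddling_slope_le_def by blast
    show "\<exists>d>0. \<forall>s s'. s \<in> S \<inter> ball t d \<and> s' \<in> S \<inter> ball t d \<and> s \<le> t \<and> t \<le> s' \<longrightarrow>
        norm (x s' - y s') - norm (x s - y s) \<le> (l - a * norm (x t - y t) + \<epsilon>) * (s' - s)"
    proof (intro exI conjI allI impI)
      show "d > 0" by fact
      fix s s' assume s: "s \<in> S \<inter> ball t d \<and> s' \<in> S \<inter> ball t d \<and> s \<le> t \<and> t \<le> s'"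
      then have "norm (x s' - y s') - norm (x s - y s) \<le> w s' - w s + l * (s' - s)"
        using compare by auto
      also have "\<dots> \<le> (- a * norm e + \<epsilon>) * (s' - s) + l * (s' - s)"
        using *[OF s] by simp
      finally show "norm (x s' - y s') - norm (x s - y s) \<le> (l - a * norm (x t - y t) + \<epsilon>) * (s' - s)"
        by (simp add: e_def algebra_simps)
    qed
  qed
qed

section \<open>Tracking a moving optimizer\<close>

theorem proposition9:
  fixes f :: "(real ^ 'n) \<times> (real ^ 'r) \<Rightarrow> real"
    and h :: "(real ^ 'n) \<times> (real ^ 'r) \<Rightarrow> real ^ 'p"
    and g :: "(real ^ 'n) \<times> (real ^ 'r) \<Rightarrow> real ^ 'm"
    and \<Xi> :: "(real ^ 'r) set"
    and \<xi> :: "real \<Rightarrow> real ^ 'r"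
    and xstar x :: "real \<Rightarrow> real ^ 'n"
    and l a :: real
  assumes f_C2: "C2_on f (UNIV \<times> \<Xi>)"
    and h_C2: "C2_on h (UNIV \<times> \<Xi>)"
    and g_C2: "C2_on g (UNIV \<times> \<Xi>)"
    and \<xi>_in: "\<And>t. t \<ge> 0 \<Longrightarrow> \<xi> t \<in> \<Xi>"
    and unique_optimizer: "\<And>t. t \<ge> 0 \<Longrightarrow> \<exists>!z. global_optimizer f h g (\<xi> t) z"
    and xstar_optimizer: "\<And>t. t \<ge> 0 \<Longrightarrow> global_optimizer f h g (\<xi> t) (xstar t)"
    and xstar_lipschitz: "l-lipschitz_on {0..} xstar"
    and x_abs_continuous: "abs_continuous_nonneg x"
    and a_pos: "a > 0"
    and contraction: "AE t in lebesgue. t \<ge> 0 \<longrightarrow>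
          x differentiable (at t) \<and>
          vector_derivative x (at t) \<bullet> (x t - xstar t) \<le> - a * (norm (x t - xstar t))\<^sup>2"
  shows "Limsup at_top (\<lambda>t. ereal (norm (x t - xstar t))) \<le> ereal (l / a) \<and>
    (norm (x 0 - xstar 0) \<le> l / a \<longrightarrow> (\<forall>t\<ge>0. norm (x t - xstar t) \<le> l / a))"
proof -
  define u where "u = (\<lambda>t. norm (x t - xstar t))"
  have "l \<ge> 0" using xstar_lipschitz by (rule lipschitz_on_nonneg)
  then have la: "l / a \<ge> 0" using a_pos by simp
  obtain N where N: "N \<in> null_sets lebesgue"
    and off_N: "\<And>t. t \<notin> N \<Longrightarrow> t \<ge> 0 \<Longrightarrow> x differentiable (at t) \<and>
        vector_derivative x (at t) \<bullet> (x t - xstar t) \<le> - a * (norm (x t - xstar t))\<^sup>2"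
    using AE_E3[OF contraction] by auto
  have ac: "abs_continuous_on_interval u b c" if "0 \<le> b" "b \<le> c" for b c
    unfolding u_def
  proof (rule abs_continuous_dist_lipschitz)
    show "abs_continuous_on_interval x b c"
      using x_abs_continuous that unfolding abs_continuous_nonneg_def by blast
    show "l-lipschitz_on {b..c} xstar"
      using lipschitz_on_subset[OF xstar_lipschitz] that by auto
  qed
  have slope: "straddling_slope_le u {0..} (l - a * r) t"
    if "t \<ge> 0" "t \<notin> N" "r \<ge> 0" "u t > r" for t r
  proof (rule straddling_slope_le_mono)
    show "straddling_slope_le u {0..} (l - a * u t) t"
      unfolding u_def
    proof (rule straddling_slope_dist_lipschitz[OF _ xstar_lipschitz])
      show "(x has_vector_derivative vector_derivative x (at t)) (at t)"
        using off_N that vector_derivative_works by blast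
      show "x t \<noteq> xstar t" using that by (auto simp: u_def)
      show "vector_derivative x (at t) \<bullet> (x t - xstar t) \<le> - a * (norm (x t - xstar t))\<^sup>2"
        using off_N that by blast
    qed (use that in simp)
    show "l - a * u t \<le> l - a * r" using that a_pos by simp
  qed simp
  have stays: "u c \<le> r" if "r \<ge> l / a" "0 \<le> b" "b \<le> c" "u b \<le> r" for b c r
  proof (rule abs_continuous_stays_below[where \<phi> = u and b = b, OF _ _ N])
    show "abs_continuous_on_interval u b c" using ac that by blast
    fix t assume t: "t \<in> {b..c} - N" "u t > r"
    have "straddling_slope_le u {0..} (l - a * r) t"
      using slope t that la by auto
    then show "straddling_slope_le u {b..c} 0 t"
      by (rule straddling_slope_le_mono) (use that a_pos in \<open>auto simp: field_simps\<close>)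
  qed (use that in auto)
  have reaches: "\<exists>S\<ge>0. u S \<le> r" if r: "r > l / a" for r
  proof (rule ccontr)
    assume "\<not> (\<exists>S\<ge>0. u S \<le> r)"
    then have above: "u t > r" if "t \<ge> 0" for t using that by force
    define k where "k = a * r - l"
    have "k > 0" using r a_pos by (simp add: k_def field_simps)
    \<comment> \<open>At this time a decrease at rate \<open>k\<close> has used up the initial value.\<close>
    define T where "T = u 0 / k"
    have "T \<ge> 0" using \<open>k > 0\<close> by (simp add: T_def u_def)
    have "u T - u 0 \<le> (l - a * r) * (T - 0)"
    proof (rule abs_continuous_slope_bound[where \<phi> = u, OF _ _ N])
      show "abs_continuous_on_interval u 0 T" using ac \<open>T \<ge> 0\<close> by blast
      fix t assume t: "t \<in> {0..T} - N"
      then have "straddling_slope_le u {0..} (l - a * r) t"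
        using slope above r la by auto
      then show "straddling_slope_le u {0..T} (l - a * r) t"
        by (rule straddling_slope_le_mono) auto
    qed (use \<open>T \<ge> 0\<close> in auto)
    also have "\<dots> = - u 0" using \<open>k > 0\<close> by (simp add: T_def k_def field_simps)
    finally have "u T \<le> 0" by simp
    with above[OF \<open>T \<ge> 0\<close>] r la show False by simp
  qed
  have "Limsup at_top (\<lambda>t. ereal (u t)) \<le> ereal (l / a)"
  proof (rule ereal_le_epsilon2)
    fix \<epsilon> :: real assume "\<epsilon> > 0"
    then obtain S where S: "S \<ge> 0" "u S \<le> l / a + \<epsilon>"
      using reaches[of "l / a + \<epsilon>"] by auto
    have "eventually (\<lambda>t. ereal (u t) \<le> ereal (l / a) + ereal \<epsilon>) at_top"
      using eventually_ge_at_top[of S]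
      by eventually_elim (use stays[of "l / a + \<epsilon>" S] S \<open>\<epsilon> > 0\<close> in auto)
    then show "Limsup at_top (\<lambda>t. ereal (u t)) \<le> ereal (l / a) + ereal \<epsilon>"
      by (rule Limsup_bounded)
  qed
  moreover have "\<forall>t\<ge>0. u t \<le> l / a" if "u 0 \<le> l / a"
    using stays[of "l / a" 0] that by auto
  ultimately show ?thesis unfolding u_def by blast
qed

end
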